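(* For labeled posets $(P,\omega),(P',\omega'),(Q,\psi),(Q',\psi')$, any two of the following conditions imply the third: (1) $(P,\omega)\sim(P',\omega')$; (2) $(Q,\psi)\sim(Q',\psi')$; (3) $(P\oplus Q,\omega\oplus\psi)\sim(P'\oplus Q',\omega'\oplus\psi')$.
   Context: All posets are finite. A labeled poset $(P,\omega)$ is a poset $P$ with a bijection $\omega:P\to[|P|]=\{1,\dots,|P|\}$. Its order polynomial $\Omega_{P,\omega}(m)$ is the number of maps $f:P\to[m]$ with $f(x)\le f(y)$ whenever $x\le y$, and $f(x)<f(y)$ whenever $x<y$ and $\omega(x)>\omega(y)$; it is a polynomial in $m$. Write $(P,\omega)\sim(Q,\psi)$ when $\Omega_{P,\omega}=\Omega_{Q,\psi}$. The ordinal sum $P\oplus Q$ is the poset on the disjoint union of $P$ and $Q$ that keeps the relations of $P$ and of $Q$ and adds $x\le y$ for all $x\in P$, $y\in Q$. The labeling $\omega\oplus\psi$ of $P\oplus Q$ is $(\omega\oplus\psi)(x)=\omega(x)$ for $x\in P$ and $(\omega\oplus\psi)(x)=|P|+\psi(x)$ for $x\in Q$. *)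

theory Defs
  imports Main "HOL-Library.FuncSet"
begin

record 'a labeled_poset =
  elts :: "'a set"
  rel :: "('a \<times> 'a) set"
  label :: "'a \<Rightarrow> nat"

definition is_labeled_poset :: "'a labeled_poset \<Rightarrow> bool" where
  "is_labeled_poset P \<longleftrightarrow>
     finite (elts P) \<and> partial_order_on (elts P) (rel P) \<and>
     bij_betw (label P) (elts P) {1..card (elts P)}"

(* Maps are extensional outside the ground set, so that each map from the poset
   to {1..m} is counted exactly once. *)
definition P_partitions :: "'a labeled_poset \<Rightarrow> nat \<Rightarrow> ('a \<Rightarrow> nat) set" where
  "P_partitions P m =
     {f \<in> elts P \<rightarrow>\<^sub>E {1..m}.
        (\<forall>x\<in>elts P. \<forall>y\<in>elts P. (x, y) \<in> rel P \<longrightarrow> f x \<le> f y) \<and>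
        (\<forall>x\<in>elts P. \<forall>y\<in>elts P.
           (x, y) \<in> rel P \<and> x \<noteq> y \<and> label P x > label P y \<longrightarrow> f x < f y)}"

(* The order polynomial as the function that counts these maps. A polynomial is
   determined by its values at the natural numbers, so equality of these functions
   is equality of polynomials. The argument m = 0 is harmless: the polynomial takes
   the value 0 there for a nonempty poset and 1 for the empty one, which is the
   number of maps into the empty set. *)
definition order_polynomial :: "'a labeled_poset \<Rightarrow> nat \<Rightarrow> nat" where
  "order_polynomial P m = card (P_partitions P m)"

definition order_equiv :: "'a labeled_poset \<Rightarrow> 'b labeled_poset \<Rightarrow> bool"  (infix "\<sim>\<^sub>\<Omega>" 50) where
  "P \<sim>\<^sub>\<Omega> Q \<longleftrightarrow> order_polynomial P = order_polynomial Q"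

definition ordinal_sum :: "'a labeled_poset \<Rightarrow> 'b labeled_poset \<Rightarrow> ('a + 'b) labeled_poset"
    (infixr "\<oplus>\<^sub>L" 65) where
  "P \<oplus>\<^sub>L Q =
     \<lparr>elts = elts P <+> elts Q,
      rel = {(Inl x, Inl y) | x y. (x, y) \<in> rel P}
          \<union> {(Inr x, Inr y) | x y. (x, y) \<in> rel Q}
          \<union> {(Inl x, Inr y) | x y. x \<in> elts P \<and> y \<in> elts Q},
      label = case_sum (label P) (\<lambda>y. card (elts P) + label Q y)\<rparr>"

lemma is_labeled_poset_ordinal_sum:
  assumes "is_labeled_poset P" "is_labeled_poset Q"
  shows "is_labeled_poset (P \<oplus>\<^sub>L Q)"
proof -
  let ?A = "elts P" and ?B = "elts Q"
  let ?f = "case_sum (label P) (\<lambda>y. card ?A + label Q y)"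
  have fin: "finite ?A" "finite ?B"
    and po: "partial_order_on ?A (rel P)" "partial_order_on ?B (rel Q)"
    and bij: "bij_betw (label P) ?A {1..card ?A}" "bij_betw (label Q) ?B {1..card ?B}"
    using assms by (auto simp: is_labeled_poset_def)
  have rel_iff: "(Inl x, Inl x') \<in> rel (P \<oplus>\<^sub>L Q) \<longleftrightarrow> (x, x') \<in> rel P"
      "(Inr y, Inr y') \<in> rel (P \<oplus>\<^sub>L Q) \<longleftrightarrow> (y, y') \<in> rel Q"
      "(Inl x, Inr y) \<in> rel (P \<oplus>\<^sub>L Q) \<longleftrightarrow> x \<in> ?A \<and> y \<in> ?B"
      "(Inr y, Inl x) \<notin> rel (P \<oplus>\<^sub>L Q)" for x x' y y'
    by (auto simp: ordinal_sum_def)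
  have sub: "rel P \<subseteq> ?A \<times> ?A" "rel Q \<subseteq> ?B \<times> ?B"
    and refl: "refl_on ?A (rel P)" "refl_on ?B (rel Q)"
    and trans: "trans (rel P)" "trans (rel Q)"
    and antisym: "antisym (rel P)" "antisym (rel Q)"
    using po by (auto simp: partial_order_on_def preorder_on_def)
  have "rel (P \<oplus>\<^sub>L Q) \<subseteq> (?A <+> ?B) \<times> (?A <+> ?B)"
    using sub by (auto simp: ordinal_sum_def)
  moreover have "refl_on (?A <+> ?B) (rel (P \<oplus>\<^sub>L Q))"
    using refl by (auto simp: refl_on_def rel_iff)
  moreover have "trans (rel (P \<oplus>\<^sub>L Q))"
  proof (rule transI)
    fix x y z assume "(x, y) \<in> rel (P \<oplus>\<^sub>L Q)" "(y, z) \<in> rel (P \<oplus>\<^sub>L Q)"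
    then show "(x, z) \<in> rel (P \<oplus>\<^sub>L Q)"
      using sub by (cases x; cases y; cases z) (auto simp: rel_iff intro: transD[OF trans(1)] transD[OF trans(2)])
  qed
  moreover have "antisym (rel (P \<oplus>\<^sub>L Q))"
  proof (rule antisymI)
    fix x y assume "(x, y) \<in> rel (P \<oplus>\<^sub>L Q)" "(y, x) \<in> rel (P \<oplus>\<^sub>L Q)"
    then show "x = y"
      by (cases x; cases y) (auto simp: rel_iff dest: antisymD[OF antisym(1)] antisymD[OF antisym(2)])
  qed
  ultimately have "partial_order_on (?A <+> ?B) (rel (P \<oplus>\<^sub>L Q))"
    by (simp add: partial_order_on_def preorder_on_def)
  moreover have "bij_betw ?f (?A <+> ?B) {1..card (?A <+> ?B)}"
  proof -
    have lab: "1 \<le> label P a" "label P a \<le> card ?A" if "a \<in> ?A" for a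
      using bij_betwE[OF bij(1)] that by auto
    have lab': "1 \<le> label Q b" "label Q b \<le> card ?B" if "b \<in> ?B" for b
      using bij_betwE[OF bij(2)] that by auto
    have "inj_on ?f (?A <+> ?B)"
    proof (rule inj_onI)
      fix x y assume *: "x \<in> ?A <+> ?B" "y \<in> ?A <+> ?B" "?f x = ?f y"
      show "x = y"
      proof (cases x; cases y)
        fix a b assume "x = Inl a" "y = Inr b"
        then show ?thesis using * lab[of a] lab'[of b] by auto
      next
        fix a b assume "x = Inr b" "y = Inl a"
        then show ?thesis using * lab[of a] lab'[of b] by auto
      qed (use * bij in \<open>auto simp: bij_betw_def dest: inj_onD\<close>)
    qed
    moreover have "?f ` (?A <+> ?B) \<subseteq> {1..card (?A <+> ?B)}"
      using lab lab' fin by (fastforce simp: card_Plus)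
    ultimately show ?thesis
      using fin by (simp add: bij_betw_def card_image card_subset_eq)
  qed
  ultimately show ?thesis
    using fin by (simp add: is_labeled_poset_def ordinal_sum_def)
qed

end

theory Submission
  imports Defs "HOL-Computational_Algebra.Formal_Power_Series"
begin

text \<open>
  Let \<open>G\<^sub>P(x)\<close> be the generating function of \<open>\<Omega>\<^sub>P(1), \<Omega>\<^sub>P(2), \<dots>\<close>. The labeling of
  \<open>P \<oplus> Q\<close> puts all labels of \<open>Q\<close> above those of \<open>P\<close>, so a \<open>P \<oplus> Q\<close>-partition is a pair
  \<open>(f, g)\<close> in which no value of \<open>f\<close> exceeds a value of \<open>g\<close>. Grouping these pairs by the
  largest value of \<open>f\<close> and shifting \<open>g\<close> down accordingly gives a convolution
  (\<open>bij_betw_ordinal_sum_partitions\<close>). The maps \<open>f\<close> with prescribed largest value \<open>i\<close> are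
  counted by \<open>\<Omega>\<^sub>P(i) - \<Omega>\<^sub>P(i - 1)\<close>, or by \<open>\<Omega>\<^sub>P(1)\<close> if \<open>i = 1\<close>, and taking these
  differences is multiplication by \<open>1 - x\<close>. Hence \<open>G\<^bsub>P \<oplus> Q\<^esub> = (1 - x) G\<^sub>P G\<^sub>Q\<close>
  (\<open>order_fps_ordinal_sum\<close>).

  Formal power series over the integers form an integral domain and none of the factors
  vanishes (\<open>order_fps_nonzero\<close>), so any two of \<open>G\<^sub>P\<close>, \<open>G\<^sub>Q\<close>, \<open>G\<^bsub>P \<oplus> Q\<^esub>\<close> determine the
  third. Finally, \<open>G\<^sub>P\<close> determines the remaining value \<open>\<Omega>\<^sub>P(0)\<close>, because that value only
  records whether \<open>P\<close> is empty, and \<open>\<Omega>\<^sub>P\<close> is constantly \<open>1\<close> on the positive integers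
  exactly for empty \<open>P\<close> (\<open>order_equiv_iff_order_fps_eq\<close>).

  Starting the generating function at \<open>\<Omega>\<^sub>P(1)\<close> makes the product formula hold for empty
  posets as well: their series is \<open>1 / (1 - x)\<close>, which cancels the factor \<open>1 - x\<close>.
\<close>

section \<open>P-partitions and their largest value\<close>

lemma finite_P_partitions:
  assumes "finite (elts P)"
  shows "finite (P_partitions P m)"
proof -
  have "finite (elts P \<rightarrow>\<^sub>E {1..m})"
    using assms by (intro finite_PiE) auto
  then show ?thesis
    by (rule rev_finite_subset) (auto simp: P_partitions_def)
qed

lemma P_partitions_bounds:
  assumes "f \<in> P_partitions P m" "x \<in> elts P"
  shows "1 \<le> f x" "f x \<le> m"
  using assms by (auto simp: P_partitions_def PiE_iff)

lemma P_partitions_change_bound_iff: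
  assumes "f \<in> P_partitions P m"
  shows "f \<in> P_partitions P k \<longleftrightarrow> (\<forall>x\<in>elts P. f x \<le> k)"
  using assms by (auto simp: P_partitions_def PiE_iff)

text \<open>The values are positive integers, so inserting \<open>1\<close> changes the maximum only on the empty
  set. There the value \<open>1\<close> means that an empty first summand leaves the partitions of the second
  one unshifted.\<close>

definition top_value :: "'a set \<Rightarrow> ('a \<Rightarrow> nat) \<Rightarrow> nat" where
  "top_value A f = Max (insert 1 (f ` A))"

lemma top_value_le_iff:
  assumes "finite A"
  shows "top_value A f \<le> k \<longleftrightarrow> 1 \<le> k \<and> (\<forall>x\<in>A. f x \<le> k)"
  using assms by (auto simp: top_value_def)

definition P_partitions_with_top :: "'a labeled_poset \<Rightarrow> nat \<Rightarrow> ('a \<Rightarrow> nat) set" where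
  "P_partitions_with_top P k = {f \<in> P_partitions P k. top_value (elts P) f = k}"

lemma card_P_partitions_with_top_1:
  assumes "finite (elts P)"
  shows "card (P_partitions_with_top P 1) = order_polynomial P 1"
proof -
  have "top_value (elts P) f = 1" if "f \<in> P_partitions P 1" for f
  proof (rule antisym)
    show "top_value (elts P) f \<le> 1"
      using P_partitions_bounds[OF that] assms by (auto simp: top_value_le_iff)
    show "1 \<le> top_value (elts P) f"
      using assms by (simp add: top_value_def)
  qed
  then have "P_partitions_with_top P 1 = P_partitions P 1"
    by (auto simp: P_partitions_with_top_def)
  then show ?thesis
    by (simp add: order_polynomial_def)
qed

text \<open>This fails for \<open>k = 0\<close> and empty \<open>P\<close>, as then \<open>\<Omega>\<^sub>P(0) = 1\<close>; the
  least possible top value is therefore counted separately.\<close>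

lemma card_P_partitions_with_top_Suc:
  assumes "finite (elts P)" "1 \<le> k"
  shows "int (card (P_partitions_with_top P (Suc k)))
       = int (order_polynomial P (Suc k)) - int (order_polynomial P k)"
proof -
  have sub: "P_partitions P k \<subseteq> P_partitions P (Suc k)"
    by (auto simp: P_partitions_def PiE_iff)
  have "f \<in> P_partitions_with_top P (Suc k)
      \<longleftrightarrow> f \<in> P_partitions P (Suc k) - P_partitions P k" for f
  proof (cases "f \<in> P_partitions P (Suc k)")
    case True
    have "top_value (elts P) f \<le> Suc k"
      using P_partitions_bounds[OF True] assms by (auto simp: top_value_le_iff)
    moreover have "f \<in> P_partitions P k \<longleftrightarrow> top_value (elts P) f \<le> k"
      using P_partitions_change_bound_iff[OF True] assms by (simp add: top_value_le_iff)
    ultimately show ?thesis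
      using True by (auto simp: P_partitions_with_top_def)
  qed (auto simp: P_partitions_with_top_def)
  then have "P_partitions_with_top P (Suc k) = P_partitions P (Suc k) - P_partitions P k"
    by blast
  moreover have "card (P_partitions P k) \<le> card (P_partitions P (Suc k))"
    using sub assms by (intro card_mono finite_P_partitions)
  ultimately show ?thesis
    using sub assms
    by (simp add: order_polynomial_def card_Diff_subset finite_P_partitions of_nat_diff)
qed

section \<open>Partitions of an ordinal sum\<close>

text \<open>The relations from \<open>P\<close> to \<open>Q\<close> go from smaller to larger labels, so they impose only weak
  inequalities.\<close>

lemma P_partitions_ordinal_sum_iff:
  assumes "is_labeled_poset P"
  shows "h \<in> P_partitions (P \<oplus>\<^sub>L Q) m \<longleftrightarrow>
      h \<circ> Inl \<in> P_partitions P m \<and> h \<circ> Inr \<in> P_partitions Q m \<and>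
      (\<forall>x\<in>elts P. \<forall>y\<in>elts Q. h (Inl x) \<le> h (Inr y))"
proof -
  have "label P x \<le> card (elts P)" if "x \<in> elts P" for x
    using assms that by (auto simp: is_labeled_poset_def dest: bij_betwE)
  then have no_descent: "\<not> card (elts P) + k < label P x" if "x \<in> elts P" for x k
    using that by fastforce
  have dom: "h \<in> (elts P <+> elts Q) \<rightarrow>\<^sub>E M \<longleftrightarrow>
      h \<circ> Inl \<in> elts P \<rightarrow>\<^sub>E M \<and> h \<circ> Inr \<in> elts Q \<rightarrow>\<^sub>E M" for M
    by (auto simp: PiE_iff extensional_def split_sum_all)
  have ball_Plus: "(\<forall>x\<in>elts P <+> elts Q. R x)
      \<longleftrightarrow> (\<forall>x\<in>elts P. R (Inl x)) \<and> (\<forall>y\<in>elts Q. R (Inr y))" for R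
    by auto
  show ?thesis
    unfolding P_partitions_def mem_Collect_eq
    by (auto simp: ordinal_sum_def dom ball_Plus no_descent)
qed

definition shift_on :: "'a set \<Rightarrow> nat \<Rightarrow> ('a \<Rightarrow> nat) \<Rightarrow> 'a \<Rightarrow> nat" where
  "shift_on A i g = (\<lambda>y\<in>A. g y + i)"

lemma shift_on_mem_P_partitions_iff:
  assumes "i \<le> n" "g \<in> extensional (elts Q)"
  shows "shift_on (elts Q) i g \<in> P_partitions Q (Suc n) \<and>
           (\<forall>y\<in>elts Q. Suc i \<le> shift_on (elts Q) i g y)
       \<longleftrightarrow> g \<in> P_partitions Q (Suc (n - i))"
  using assms by (auto simp: P_partitions_def shift_on_def PiE_iff)

text \<open>A partition \<open>h\<close> of \<open>P \<oplus> Q\<close> splits into its restriction to \<open>P\<close>, with largest value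
  \<open>i + 1\<close>, and its restriction to \<open>Q\<close>, whose values lie between \<open>i + 1\<close> and \<open>n + 1\<close> and
  therefore form an arbitrary partition with bound \<open>n - i + 1\<close> after a shift by \<open>i\<close>.\<close>

lemma bij_betw_ordinal_sum_partitions:
  assumes "is_labeled_poset P"
  shows "bij_betw (\<lambda>(i, f, g). case_sum f (shift_on (elts Q) i g))
           (SIGMA i:{0..n}. P_partitions_with_top P (Suc i) \<times> P_partitions Q (Suc (n - i)))
           (P_partitions (P \<oplus>\<^sub>L Q) (Suc n))"
    (is "bij_betw ?join ?S ?T")
proof -
  define split where "split h =
      (let i = top_value (elts P) (h \<circ> Inl) - 1
       in (i, h \<circ> Inl, \<lambda>y\<in>elts Q. h (Inr y) - i))" for h :: "'a + 'b \<Rightarrow> nat"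
  have fin: "finite (elts P)"
    using assms by (simp add: is_labeled_poset_def)
  have case_sum_comp: "case_sum f g \<circ> Inl = f" "case_sum f g \<circ> Inr = g"
    for f :: "'a \<Rightarrow> nat" and g :: "'b \<Rightarrow> nat"
    by auto
  show ?thesis
  proof (rule bij_betw_byWitness[where f' = split])
    show "\<forall>p\<in>?S. split (?join p) = p"
      by (auto simp: split_def case_sum_comp P_partitions_with_top_def shift_on_def
          P_partitions_def PiE_iff intro!: extensionalityI[where A = "elts Q"])
  next
    show "?join ` ?S \<subseteq> ?T"
    proof safe
      fix i f g
      assume i: "i \<in> {0..n}" and f: "f \<in> P_partitions_with_top P (Suc i)"
        and g: "g \<in> P_partitions Q (Suc (n - i))"
      have fi: "f \<in> P_partitions P (Suc i)"
        using f by (simp add: P_partitions_with_top_def)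
      have "f \<in> P_partitions P (Suc n)"
        using fi i by (auto simp: P_partitions_def PiE_iff)
      moreover have gn: "shift_on (elts Q) i g \<in> P_partitions Q (Suc n)"
          "\<forall>y\<in>elts Q. Suc i \<le> shift_on (elts Q) i g y"
        using shift_on_mem_P_partitions_iff[of i n g Q] g i
        by (auto simp: P_partitions_def PiE_iff)
      moreover have "f x \<le> shift_on (elts Q) i g y" if "x \<in> elts P" "y \<in> elts Q" for x y
        using P_partitions_bounds(2)[OF fi that(1)] gn(2) that(2) by (meson le_trans)
      ultimately show "case_sum f (shift_on (elts Q) i g) \<in> ?T"
        using assms by (simp add: P_partitions_ordinal_sum_iff case_sum_comp)
    qed
  next
    have "split h \<in> ?S \<and> ?join (split h) = h" if h: "h \<in> ?T" for h
    proof -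
      define i where "i = top_value (elts P) (h \<circ> Inl) - 1"
      define g where "g = (\<lambda>y\<in>elts Q. h (Inr y) - i)"
      have hP: "h \<circ> Inl \<in> P_partitions P (Suc n)" and hQ: "h \<circ> Inr \<in> P_partitions Q (Suc n)"
        and le: "\<And>x y. x \<in> elts P \<Longrightarrow> y \<in> elts Q \<Longrightarrow> h (Inl x) \<le> h (Inr y)"
        using h assms by (auto simp: P_partitions_ordinal_sum_iff)
      have "1 \<le> top_value (elts P) (h \<circ> Inl)"
        using fin by (simp add: top_value_def)
      then have top: "top_value (elts P) (h \<circ> Inl) = Suc i"
        by (simp add: i_def)
      have "i \<le> n"
        using top_value_le_iff[OF fin, of "h \<circ> Inl" "Suc n"] P_partitions_bounds[OF hP] top
        by auto
      have above: "Suc i \<le> h (Inr y)" if "y \<in> elts Q" for y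
        using top_value_le_iff[OF fin, of "h \<circ> Inl" "h (Inr y)"] le[OF _ that]
          P_partitions_bounds(1)[OF hQ that] top by auto
      have "h \<circ> Inl \<in> P_partitions_with_top P (Suc i)"
        using P_partitions_change_bound_iff[OF hP] top_value_le_iff[OF fin, of "h \<circ> Inl" "Suc i"] top
        by (auto simp: P_partitions_with_top_def)
      moreover have shift: "shift_on (elts Q) i g = h \<circ> Inr"
      proof (rule extensionalityI[where A = "elts Q"])
        show "h \<circ> Inr \<in> extensional (elts Q)"
          using hQ by (auto simp: P_partitions_def PiE_iff)
      qed (use above in \<open>fastforce simp: shift_on_def g_def\<close>)+
      moreover have "g \<in> P_partitions Q (Suc (n - i))"
        using shift_on_mem_P_partitions_iff[OF \<open>i \<le> n\<close>, of g Q] shift hQ above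
        by (auto simp: g_def)
      moreover have "split h = (i, h \<circ> Inl, g)"
        by (simp add: split_def i_def g_def Let_def)
      moreover have "case_sum (h \<circ> Inl) (h \<circ> Inr) = h"
        by (auto simp: fun_eq_iff split: sum.split)
      ultimately show ?thesis
        using \<open>i \<le> n\<close> by simp
    qed
    then show "\<forall>h\<in>?T. ?join (split h) = h" "split ` ?T \<subseteq> ?S"
      by blast+
  qed
qed

section \<open>The generating function\<close>

definition order_fps :: "'a labeled_poset \<Rightarrow> int fps" where
  "order_fps P = Abs_fps (\<lambda>n. int (order_polynomial P (Suc n)))"

text \<open>In degree \<open>0\<close> the product keeps \<open>\<Omega>\<^sub>P(1)\<close> unchanged, which is the right count for
  the top value \<open>1\<close>.\<close>

lemma order_fps_difference_nth:
  assumes "finite (elts P)"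
  shows "fps_nth ((1 - fps_X) * order_fps P) n = int (card (P_partitions_with_top P (Suc n)))"
proof (cases n)
  case 0
  then show ?thesis
    using card_P_partitions_with_top_1[OF assms]
    by (simp add: order_fps_def left_diff_distrib)
next
  case (Suc k)
  then show ?thesis
    using card_P_partitions_with_top_Suc[OF assms, of "Suc k"]
    by (simp add: order_fps_def left_diff_distrib)
qed

lemma order_fps_ordinal_sum:
  assumes "is_labeled_poset P" "is_labeled_poset Q"
  shows "order_fps (P \<oplus>\<^sub>L Q) = (1 - fps_X) * order_fps P * order_fps Q"
proof (rule fps_ext)
  fix n
  have fin: "finite (elts P)" "finite (elts Q)"
    using assms by (auto simp: is_labeled_poset_def)
  have "order_polynomial (P \<oplus>\<^sub>L Q) (Suc n) =
      card (SIGMA i:{0..n}. P_partitions_with_top P (Suc i) \<times> P_partitions Q (Suc (n - i)))"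
    unfolding order_polynomial_def
    by (rule bij_betw_same_card[OF bij_betw_ordinal_sum_partitions[OF assms(1)], symmetric])
  also have "\<dots> = (\<Sum>i=0..n. card (P_partitions_with_top P (Suc i)) *
                          order_polynomial Q (Suc (n - i)))"
    using fin
    by (subst card_SigmaI)
      (auto simp: card_cartesian_product order_polynomial_def P_partitions_with_top_def
        finite_P_partitions)
  finally show "fps_nth (order_fps (P \<oplus>\<^sub>L Q)) n = fps_nth ((1 - fps_X) * order_fps P * order_fps Q) n"
    by (simp add: fps_mult_nth[of _ "order_fps Q"] order_fps_difference_nth[OF fin(1)])
      (simp add: order_fps_def)
qed

section \<open>What the generating function determines\<close>

text \<open>The size of the principal down-set is strictly increasing along the order, hence a partition
  whatever the labeling is.\<close>

lemma down_set_card_mem_P_partitions: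
  assumes "is_labeled_poset P" "card (elts P) + c \<le> m"
  shows "(\<lambda>x\<in>elts P. card {z. (z, x) \<in> rel P} + c) \<in> P_partitions P m"
proof -
  have fin: "finite (elts P)" and sub: "rel P \<subseteq> elts P \<times> elts P"
    and refl: "refl_on (elts P) (rel P)" and tr: "trans (rel P)" and asym: "antisym (rel P)"
    using assms(1) by (auto simp: is_labeled_poset_def partial_order_on_def preorder_on_def)
  have down: "{z. (z, x) \<in> rel P} \<subseteq> elts P" for x
    using sub by auto
  then have fin_down: "finite {z. (z, x) \<in> rel P}" for x
    using fin finite_subset by blast
  have le: "card {z. (z, x) \<in> rel P} \<le> card (elts P)" for x
    using down fin by (simp add: card_mono)
  have pos: "0 < card {z. (z, x) \<in> rel P}" if "x \<in> elts P" for x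
    using refl_onD[OF refl that] fin_down by (auto simp: card_gt_0_iff)
  have mono: "card {z. (z, x) \<in> rel P} < card {z. (z, y) \<in> rel P}"
    if "(x, y) \<in> rel P" "x \<noteq> y" for x y
  proof (rule psubset_card_mono[OF fin_down])
    have "(y, y) \<in> rel P" "(y, x) \<notin> rel P"
      using that sub refl_onD[OF refl] by (auto dest: antisymD[OF asym])
    then show "{z. (z, x) \<in> rel P} \<subset> {z. (z, y) \<in> rel P}"
      using that(1) by (blast dest: transD[OF tr])
  qed
  have "card {z. (z, x) \<in> rel P} + c \<le> m" for x
    using le[of x] assms(2) by linarith
  moreover have "card {z. (z, x) \<in> rel P} \<le> card {z. (z, y) \<in> rel P}" if "(x, y) \<in> rel P" for x y
    using mono[OF that] by (cases "x = y") auto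
  ultimately show ?thesis
    using pos mono by (auto simp: P_partitions_def Suc_le_eq)
qed

lemma order_fps_nonzero:
  assumes "is_labeled_poset P"
  shows "order_fps P \<noteq> 0"
proof -
  have "P_partitions P (Suc (card (elts P))) \<noteq> {}"
    using down_set_card_mem_P_partitions[OF assms, of 0 "Suc (card (elts P))"] by auto
  then have "fps_nth (order_fps P) (card (elts P)) \<noteq> 0"
    using assms
    by (simp add: order_fps_def order_polynomial_def finite_P_partitions is_labeled_poset_def)
  then show ?thesis
    by auto
qed

lemma order_polynomial_0:
  "order_polynomial P 0 = (if elts P = {} then 1 else 0)"
  by (auto simp: order_polynomial_def P_partitions_def PiE_eq_empty_iff)

text \<open>A partition of a nonempty poset can be shifted up by one, which gives a second one as soon as
  the bound leaves room.\<close>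

lemma elts_empty_iff_order_polynomial_one:
  assumes "is_labeled_poset P"
  shows "elts P = {} \<longleftrightarrow> (\<forall>n. order_polynomial P (Suc n) = 1)"
proof
  assume "elts P = {}"
  then show "\<forall>n. order_polynomial P (Suc n) = 1"
    by (simp add: order_polynomial_def P_partitions_def)
next
  assume one: "\<forall>n. order_polynomial P (Suc n) = 1"
  define F where "F c = (\<lambda>x\<in>elts P. card {z. (z, x) \<in> rel P} + c)" for c
  have mem: "F 0 \<in> P_partitions P (Suc (card (elts P)))" "F 1 \<in> P_partitions P (Suc (card (elts P)))"
    unfolding F_def by (rule down_set_card_mem_P_partitions[OF assms], simp)+
  have "card (P_partitions P (Suc (card (elts P)))) = 1"
    using one by (simp add: order_polynomial_def)
  then have "F 0 = F 1"
    using mem by (auto simp: card_1_singleton_iff)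
  moreover have "F 0 x \<noteq> F 1 x" if "x \<in> elts P" for x
    using that by (simp add: F_def)
  ultimately show "elts P = {}"
    by auto
qed

lemma order_equiv_iff_order_fps_eq:
  assumes "is_labeled_poset P" "is_labeled_poset Q"
  shows "P \<sim>\<^sub>\<Omega> Q \<longleftrightarrow> order_fps P = order_fps Q"
proof
  assume "P \<sim>\<^sub>\<Omega> Q"
  then show "order_fps P = order_fps Q"
    by (simp add: order_equiv_def order_fps_def)
next
  assume "order_fps P = order_fps Q"
  then have pos: "order_polynomial P (Suc n) = order_polynomial Q (Suc n)" for n
    by (simp add: order_fps_def fps_eq_iff)
  have "order_polynomial P 0 = order_polynomial Q 0"
    using elts_empty_iff_order_polynomial_one[OF assms(1)]
      elts_empty_iff_order_polynomial_one[OF assms(2)] pos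
    by (simp add: order_polynomial_0)
  then have "order_polynomial P m = order_polynomial Q m" for m
    using pos by (cases m) auto
  then show "P \<sim>\<^sub>\<Omega> Q"
    by (auto simp: order_equiv_def)
qed

section \<open>Two equivalences imply the third\<close>

theorem corollary1p3:
  fixes P :: "'a labeled_poset" and P' :: "'b labeled_poset"
    and Q :: "'c labeled_poset" and Q' :: "'d labeled_poset"
  assumes "is_labeled_poset P" and "is_labeled_poset P'"
    and "is_labeled_poset Q" and "is_labeled_poset Q'"
  shows "(P \<sim>\<^sub>\<Omega> P' \<and> Q \<sim>\<^sub>\<Omega> Q' \<longrightarrow> P \<oplus>\<^sub>L Q \<sim>\<^sub>\<Omega> P' \<oplus>\<^sub>L Q')
       \<and> (P \<sim>\<^sub>\<Omega> P' \<and> P \<oplus>\<^sub>L Q \<sim>\<^sub>\<Omega> P' \<oplus>\<^sub>L Q' \<longrightarrow> Q \<sim>\<^sub>\<Omega> Q')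
       \<and> (Q \<sim>\<^sub>\<Omega> Q' \<and> P \<oplus>\<^sub>L Q \<sim>\<^sub>\<Omega> P' \<oplus>\<^sub>L Q' \<longrightarrow> P \<sim>\<^sub>\<Omega> P')"
proof -
  have "fps_nth (1 - fps_X :: int fps) 0 \<noteq> 0"
    by simp
  then have "(1 - fps_X :: int fps) \<noteq> 0"
    by (metis fps_zero_nth)
  then show ?thesis
    using assms order_fps_nonzero[OF assms(1)] order_fps_nonzero[OF assms(3)]
      order_fps_nonzero[OF assms(2)] order_fps_nonzero[OF assms(4)]
    by (auto simp: order_equiv_iff_order_fps_eq is_labeled_poset_ordinal_sum
        order_fps_ordinal_sum)
qed

end
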